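(* Let $b>0$, $\varepsilon\ge0$, $\tau>0$, and consider the pulse coupled $3$-oscillator network with coupling strength $\varepsilon$ and delay $\tau$ described in the context, with initial states on the Poincaré surface of section $\theta_3=0$ given by $S(\bm\sigma)$, $\bm\sigma\in\Omega_{\varepsilon,\tau}$. Then the map $$g:(\sigma_1,\sigma_2,\sigma_3)\mapsto(\sigma_3-\sigma_2,\ \sigma_1-\sigma_2,\ \tau-\sigma_2)$$ has the following properties: (a) $g(\Omega_{\varepsilon,\tau})=\Omega_{\varepsilon,\tau}$; (b) $G(S(\bm\sigma))=S(g(\bm\sigma))$ for all $\bm\sigma\in\Omega_{\varepsilon,\tau}$, where $G$ is the Poincaré map of the network, given on these states by $(\sigma_1,\sigma_2,\sigma_3;\theta_1,\theta_2)\mapsto(\sigma_3-\sigma_2,\sigma_1-\sigma_2,\tau-\sigma_2;\,H(\sigma_3-\sigma_2),\sigma_1-\sigma_2)$.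
   Context: Network. There are $N=3$ identical oscillators, coupled all-to-all, with phases $\theta_1,\theta_2,\theta_3\in[0,1]$. Fix $b>0$, $\varepsilon\ge0$, $\tau>0$ and put $\hat\varepsilon=\varepsilon/(N-1)=\varepsilon/2$. For $\delta\ge 0$ let $H(\theta,\delta)=e^{b\delta}\theta+\frac{e^{b\delta}-1}{e^b-1}$ and write $H_m(\theta)=H(\theta,m\hat\varepsilon)$, $H(\theta)=H_1(\theta)$. The dynamics is: $\dot\theta_i=1$ between events; if $\theta_i(t)=1$ then oscillator $i$ fires at time $t$ (sending a pulse to each of the other oscillators, received at time $t+\tau$) and is reset, $\theta_i(t^+)=0$; if $m\ge1$ other oscillators fired at time $t-\tau$ then $\theta_i(t)=\min\{1,H_m(\theta_i(t^-))\}$. (So an oscillator that is at the threshold exactly when a pulse arrives fires once and is reset to $0$.) States. The future dynamics is determined by the phases at $t=0$ and the firing moments in $[-\tau,0]$. A state on the surface of section $\theta_3=0$ written $(\theta_1,\theta_2,0;\{\sigma_1\},\{\sigma_2\},\{\sigma_3\})$, or for short $(\sigma_1,\sigma_2,\sigma_3;\theta_1,\theta_2)$, means: at time $0$ oscillator $3$ has just fired and been reset to phase $0$ (so its pulse will be received by oscillators $1,2$ at time $\tau$), oscillators $1,2$ have phases $\theta_1,\theta_2$, and, apart from the firing of oscillator $3$ at time $0$, the only firing in the last $\tau$ time units of oscillator $i$ was at time $-\sigma_i$, $i=1,2,3$. The Poincaré map sends a state on the section to the state at the next time at which oscillator $3$ fires and is reset to $0$. Let $H_*=H_1^{-1}(1)=\frac{e^b-e^{b\hat\varepsilon}}{(e^b-1)e^{b\hat\varepsilon}}$.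 For $\bm\sigma=(\sigma_1,\sigma_2,\sigma_3)$ let $F_1=H(\sigma_1)+\tau-\sigma_3$, $F_2=H(\tau-\sigma_3+\sigma_2)+\sigma_3-\sigma_1$, $F_3=H(\tau-\sigma_1)+\sigma_1-\sigma_2$, $F_4=H(\sigma_3-\sigma_2)+\sigma_2$. Let $\Omega_{\varepsilon,\tau}\subset\mathbb R^3$ be the set of $\bm\sigma$ with $0<\sigma_2<\sigma_1<\sigma_3<\tau$ and $H_*\le F_k\le 1$ for $k=1,2,3,4$. Let $S(\sigma_1,\sigma_2,\sigma_3)=(H(\sigma_1),\sigma_2,0;\{\sigma_1\},\{\sigma_2\},\{\sigma_3\})$. *)

theory Defs
  imports "HOL-Analysis.Analysis"
begin

datatype osc = Osc1 | Osc2 | Osc3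

text \<open>The normalised coupling strength \<open>\<epsilon> / (N - 1)\<close> for \<open>N = 3\<close>.\<close>

definition eps_hat :: "real \<Rightarrow> real" where
  "eps_hat \<epsilon> = \<epsilon> / 2"

definition H :: "real \<Rightarrow> real \<Rightarrow> real \<Rightarrow> real" where
  "H b \<theta> \<delta> = exp (b * \<delta>) * \<theta> + (exp (b * \<delta>) - 1) / (exp b - 1)"

definition Hm :: "real \<Rightarrow> real \<Rightarrow> nat \<Rightarrow> real \<Rightarrow> real" where
  "Hm b \<epsilon> m \<theta> = H b \<theta> (real m * eps_hat \<epsilon>)"

definition Hstar :: "real \<Rightarrow> real \<Rightarrow> real" where
  "Hstar b \<epsilon> = (exp b - exp (b * eps_hat \<epsilon>)) / ((exp b - 1) * exp (b * eps_hat \<epsilon>))"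

lemma Hm_eq_1_iff:
  assumes "b > 0"
  shows "Hm b \<epsilon> 1 x = 1 \<longleftrightarrow> x = Hstar b \<epsilon>"
proof -
  have "exp b - 1 > 0" "exp (b * eps_hat \<epsilon>) > 0"
    using assms by simp_all
  then show ?thesis
    by (auto simp: Hm_def H_def Hstar_def field_simps)
qed

text \<open>
  A state consists of the phases after all events at the current time (that is, the right
  limits) and, for each oscillator, the set of times elapsed since its firings during the
  last \<open>\<tau>\<close> time units. The window is half-open: a firing exactly \<open>\<tau>\<close> time units ago has
  already been received and is not recorded, while a firing at the current time is recorded
  as age \<open>0\<close>.
\<close>

record state =
  phase :: "osc \<Rightarrow> real"
  ages :: "osc \<Rightarrow> real set"

text \<open>
  In the next definitions \<open>\<theta> i t\<close> is the phase of oscillator \<open>i\<close> at time \<open>t\<close>, after the pulses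
  arriving at \<open>t\<close> but before the reset, so that \<open>\<theta> i t = 1\<close> if \<open>i\<close> fires at \<open>t\<close>; and \<open>F i\<close>
  is the set of firing times of \<open>i\<close>.
\<close>

definition after_reset ::
  "(osc \<Rightarrow> real \<Rightarrow> real) \<Rightarrow> (osc \<Rightarrow> real set) \<Rightarrow> osc \<Rightarrow> real \<Rightarrow> real" where
  "after_reset \<theta> F i t = (if t \<in> F i then 0 else \<theta> i t)"

definition num_pulses :: "real \<Rightarrow> (osc \<Rightarrow> real set) \<Rightarrow> osc \<Rightarrow> real \<Rightarrow> nat" where
  "num_pulses \<tau> F i t = card {j. j \<noteq> i \<and> t - \<tau> \<in> F j}"

definition state_at ::
  "real \<Rightarrow> (osc \<Rightarrow> real \<Rightarrow> real) \<Rightarrow> (osc \<Rightarrow> real set) \<Rightarrow> real \<Rightarrow> state" where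
  "state_at \<tau> \<theta> F t =
     \<lparr>phase = (\<lambda>i. after_reset \<theta> F i t),
      ages = (\<lambda>i. {s. 0 \<le> s \<and> s < \<tau> \<and> t - s \<in> F i})\<rparr>"

definition trajectory ::
  "real \<Rightarrow> real \<Rightarrow> real \<Rightarrow> state \<Rightarrow> real \<Rightarrow>
   (osc \<Rightarrow> real \<Rightarrow> real) \<Rightarrow> (osc \<Rightarrow> real set) \<Rightarrow> bool" where
  "trajectory b \<epsilon> \<tau> s T \<theta> F \<longleftrightarrow>
     state_at \<tau> \<theta> F 0 = s \<and>
     (\<forall>i. finite (F i \<inter> {0..T})) \<and>
     (\<forall>i. \<forall>t\<in>{0..T}. 0 \<le> \<theta> i t \<and> \<theta> i t \<le> 1) \<and>
     (\<forall>i. \<forall>t\<in>{0..T}. t \<in> F i \<longleftrightarrow> \<theta> i t = 1) \<and>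
     (\<forall>i. \<forall>t\<in>{0<..<T}. t \<notin> F i \<and> num_pulses \<tau> F i t = 0 \<longrightarrow>
        (\<theta> i has_real_derivative 1) (at t)) \<and>
     (\<forall>i. \<forall>t\<in>{0<..T}. \<exists>l. (\<theta> i \<longlongrightarrow> l) (at_left t) \<and>
        \<theta> i t = (if num_pulses \<tau> F i t \<ge> 1 then min 1 (Hm b \<epsilon> (num_pulses \<tau> F i t) l) else l)) \<and>
     (\<forall>i. \<forall>t\<in>{0..<T}. (\<theta> i \<longlongrightarrow> after_reset \<theta> F i t) (at_right t))"

text \<open>The surface of section: oscillator 3 has just fired and been reset.\<close>

definition on_section :: "state \<Rightarrow> bool" where
  "on_section s \<longleftrightarrow> phase s Osc3 = 0 \<and> 0 \<in> ages s Osc3"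

definition poincare_step :: "real \<Rightarrow> real \<Rightarrow> real \<Rightarrow> state \<Rightarrow> state \<Rightarrow> bool" where
  "poincare_step b \<epsilon> \<tau> s s' \<longleftrightarrow> on_section s \<and>
     (\<exists>T \<theta> F. T > 0 \<and> trajectory b \<epsilon> \<tau> s T \<theta> F \<and>
        T \<in> F Osc3 \<and> (\<forall>t\<in>{0<..<T}. t \<notin> F Osc3) \<and> s' = state_at \<tau> \<theta> F T)"

text \<open>Defined exactly where a next section state exists and is unique.\<close>

definition poincare_map :: "real \<Rightarrow> real \<Rightarrow> real \<Rightarrow> state \<Rightarrow> state option" where
  "poincare_map b \<epsilon> \<tau> s =
     (if \<exists>!s'. poincare_step b \<epsilon> \<tau> s s'
      then Some (THE s'. poincare_step b \<epsilon> \<tau> s s') else None)"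

text \<open>
  The state \<open>(\<theta>\<^sub>1, \<theta>\<^sub>2, 0; {\<sigma>\<^sub>1}, {\<sigma>\<^sub>2}, {\<sigma>\<^sub>3})\<close>, in short \<open>(\<sigma>\<^sub>1, \<sigma>\<^sub>2, \<sigma>\<^sub>3; \<theta>\<^sub>1, \<theta>\<^sub>2)\<close>. That notation
  leaves the firing of oscillator 3 at time \<open>0\<close> implicit; here it appears as age \<open>0\<close>.
\<close>

definition section_state :: "real \<Rightarrow> real \<Rightarrow> real \<Rightarrow> real \<Rightarrow> real \<Rightarrow> state" where
  "section_state \<sigma>1 \<sigma>2 \<sigma>3 \<theta>1 \<theta>2 =
     \<lparr>phase = case_osc \<theta>1 \<theta>2 0,
      ages = case_osc {\<sigma>1} {\<sigma>2} {\<sigma>3, 0}\<rparr>"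

definition S_state :: "real \<Rightarrow> real \<Rightarrow> real \<times> real \<times> real \<Rightarrow> state" where
  "S_state b \<epsilon> = (\<lambda>(\<sigma>1, \<sigma>2, \<sigma>3). section_state \<sigma>1 \<sigma>2 \<sigma>3 (Hm b \<epsilon> 1 \<sigma>1) \<sigma>2)"

definition Omega :: "real \<Rightarrow> real \<Rightarrow> real \<Rightarrow> (real \<times> real \<times> real) set" where
  "Omega b \<epsilon> \<tau> = {(\<sigma>1, \<sigma>2, \<sigma>3).
     0 < \<sigma>2 \<and> \<sigma>2 < \<sigma>1 \<and> \<sigma>1 < \<sigma>3 \<and> \<sigma>3 < \<tau> \<and>
     Hm b \<epsilon> 1 \<sigma>1 + \<tau> - \<sigma>3 \<in> {Hstar b \<epsilon>..1} \<and>
     Hm b \<epsilon> 1 (\<tau> - \<sigma>3 + \<sigma>2) + \<sigma>3 - \<sigma>1 \<in> {Hstar b \<epsilon>..1} \<and>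
     Hm b \<epsilon> 1 (\<tau> - \<sigma>1) + \<sigma>1 - \<sigma>2 \<in> {Hstar b \<epsilon>..1} \<and>
     Hm b \<epsilon> 1 (\<sigma>3 - \<sigma>2) + \<sigma>2 \<in> {Hstar b \<epsilon>..1}}"

definition g_map :: "real \<Rightarrow> real \<times> real \<times> real \<Rightarrow> real \<times> real \<times> real" where
  "g_map \<tau> = (\<lambda>(\<sigma>1, \<sigma>2, \<sigma>3). (\<sigma>3 - \<sigma>2, \<sigma>1 - \<sigma>2, \<tau> - \<sigma>2))"

end

theory Submission
  imports Defs
begin

text \<open>
  The next firing of oscillator 3 occurs at time \<open>\<tau> - \<sigma>2\<close>. Up to then every pulse in flight was
  emitted before time \<open>0\<close>, so each oscillator evolves independently, driven by two pulses at
  known times. The bounds on the \<open>F\<^sub>k\<close> say that oscillator 1 fires at the arrival of the first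
  pulse, oscillator 2 at the second and oscillator 3 at the third, and that nobody fires between
  arrivals. The map \<open>g\<close> permutes the \<open>F\<^sub>k\<close> cyclically, whence \<open>g(\<Omega>) = \<Omega>\<close>.
\<close>

declare One_nat_def [simp del]

section \<open>The coupling function\<close>

text \<open>The coupling is excitatory: the slope is at least 1 and the constant term is
  nonnegative. Hence an upper bound on a phase after a pulse also bounds the phase before
  it.\<close>

lemma Hm_ge_self:
  assumes "b > 0" "\<epsilon> \<ge> 0" "x \<ge> 0"
  shows "x \<le> Hm b \<epsilon> m x"
proof -
  have "exp (b * (real m * eps_hat \<epsilon>)) \<ge> 1"
    using assms by (simp add: eps_hat_def)
  moreover have "exp b - 1 > 0"
    using assms by simp
  ultimately have "1 * x \<le> exp (b * (real m * eps_hat \<epsilon>)) * x"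
    and "0 \<le> (exp (b * (real m * eps_hat \<epsilon>)) - 1) / (exp b - 1)"
    using assms by (intro mult_right_mono, simp_all)
  then show ?thesis
    unfolding Hm_def H_def by linarith
qed

text \<open>\<open>Hm b \<epsilon> 1\<close> is increasing and takes the value 1 at
  \<open>Hstar b \<epsilon>\<close>. This turns the lower bounds in \<open>Omega\<close> into firing
  conditions.\<close>

lemma Hm_ge_1:
  assumes "b > 0" "Hstar b \<epsilon> \<le> x"
  shows "1 \<le> Hm b \<epsilon> 1 x"
proof -
  have "Hm b \<epsilon> 1 (Hstar b \<epsilon>) = 1"
    using assms(1) Hm_eq_1_iff by blast
  moreover have "Hm b \<epsilon> 1 (Hstar b \<epsilon>) \<le> Hm b \<epsilon> 1 x"
    using assms(2) by (simp add: Hm_def H_def)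
  ultimately show ?thesis
    by simp
qed

section \<open>A single oscillator driven by prescribed pulses\<close>

definition reset :: "real \<Rightarrow> real" where
  "reset x = (if x = 1 then 0 else x)"

text \<open>The function \<open>n\<close> counts the arriving pulses, and firing means \<open>\<theta> t = 1\<close>.\<close>

definition osc_run :: "real \<Rightarrow> real \<Rightarrow> real \<Rightarrow> (real \<Rightarrow> nat) \<Rightarrow> (real \<Rightarrow> real) \<Rightarrow> bool" where
  "osc_run b \<epsilon> T n \<theta> \<longleftrightarrow>
     finite {t \<in> {0..T}. \<theta> t = 1} \<and>
     (\<forall>t\<in>{0..T}. 0 \<le> \<theta> t \<and> \<theta> t \<le> 1) \<and>
     (\<forall>t\<in>{0<..<T}. \<theta> t \<noteq> 1 \<and> n t = 0 \<longrightarrow> (\<theta> has_real_derivative 1) (at t)) \<and>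
     (\<forall>t\<in>{0<..T}. \<exists>l. (\<theta> \<longlongrightarrow> l) (at_left t) \<and>
        \<theta> t = (if n t \<ge> 1 then min 1 (Hm b \<epsilon> (n t) l) else l)) \<and>
     (\<forall>t\<in>{0..<T}. (\<theta> \<longlongrightarrow> reset (\<theta> t)) (at_right t))"

text \<open>Decoupling: an oscillator sees the others only through the number of pulses that
  arrive.\<close>

lemma trajectory_iff_osc_run:
  "trajectory b \<epsilon> \<tau> s T \<theta> F \<longleftrightarrow>
     state_at \<tau> \<theta> F 0 = s \<and>
     (\<forall>i. \<forall>t\<in>{0..T}. t \<in> F i \<longleftrightarrow> \<theta> i t = 1) \<and>
     (\<forall>i. osc_run b \<epsilon> T (num_pulses \<tau> F i) (\<theta> i))"
proof -
  \<comment> \<open>With the firing condition granted, the clauses agree one by one; without it both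
    sides are false.\<close>
  have *: "trajectory b \<epsilon> \<tau> s T \<theta> F \<longleftrightarrow>
      state_at \<tau> \<theta> F 0 = s \<and> (\<forall>i. osc_run b \<epsilon> T (num_pulses \<tau> F i) (\<theta> i))"
    if fire: "\<And>i t. t \<in> {0..T} \<Longrightarrow> t \<in> F i \<longleftrightarrow> \<theta> i t = 1"
  proof -
    have 1: "F i \<inter> {0..T} = {t \<in> {0..T}. \<theta> i t = 1}" for i
      using fire by blast
    have 2: "after_reset \<theta> F i t = reset (\<theta> i t)" if "t \<in> {0..<T}" for i t
      using fire that by (simp add: after_reset_def reset_def)
    have 3: "(\<forall>i. \<forall>t\<in>{0..T}. t \<in> F i \<longleftrightarrow> \<theta> i t = 1) \<longleftrightarrow> True"
      using fire by blast
    have 4: "(\<forall>t\<in>{0<..<T}. t \<notin> F i \<and> num_pulses \<tau> F i t = 0 \<longrightarrow> (\<theta> i has_real_derivative 1) (at t)) \<longleftrightarrow>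
        (\<forall>t\<in>{0<..<T}. \<theta> i t \<noteq> 1 \<and> num_pulses \<tau> F i t = 0 \<longrightarrow> (\<theta> i has_real_derivative 1) (at t))" for i
      by (intro ball_cong refl) (simp add: fire)
    have 5: "(\<forall>t\<in>{0..<T}. (\<theta> i \<longlongrightarrow> after_reset \<theta> F i t) (at_right t)) \<longleftrightarrow>
        (\<forall>t\<in>{0..<T}. (\<theta> i \<longlongrightarrow> reset (\<theta> i t)) (at_right t))" for i
      by (intro ball_cong refl) (simp add: 2)
    show ?thesis
      unfolding trajectory_def osc_run_def 1 3 4 5 by blast
  qed
  show ?thesis
  proof (cases "\<forall>i. \<forall>t\<in>{0..T}. t \<in> F i \<longleftrightarrow> \<theta> i t = 1")
    case True
    then show ?thesis
      by (subst *) simp_all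
  next
    case False
    then show ?thesis
      unfolding trajectory_def by blast
  qed
qed

lemma osc_run_mono:
  assumes "osc_run b \<epsilon> T n \<theta>" "T' \<le> T"
  shows "osc_run b \<epsilon> T' n \<theta>"
proof -
  have "{t \<in> {0..T'}. \<theta> t = 1} \<subseteq> {t \<in> {0..T}. \<theta> t = 1}"
    using assms(2) by auto
  then show ?thesis
    using assms unfolding osc_run_def by (auto intro: finite_subset)
qed

text \<open>The clauses consult \<open>n\<close> only after time 0: a pulse arriving at time 0 is
  already contained in the value of \<open>\<theta> 0\<close>.\<close>

lemma osc_run_cong:
  assumes "osc_run b \<epsilon> T n \<theta>" "\<And>t. t \<in> {0<..T} \<Longrightarrow> n t = n' t"
  shows "osc_run b \<epsilon> T n' \<theta>"
  using assms by (simp add: osc_run_def cong: if_cong)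

text \<open>Slope 1 makes \<open>\<theta> t - t\<close> constant inside the interval. The right
  limit at \<open>a\<close> fixes the constant, and the left limit at \<open>c\<close> is what the
  jump rule at \<open>c\<close> acts on.\<close>

lemma linear_between_events:
  assumes run: "osc_run b \<epsilon> T n \<theta>" and a: "0 \<le> a" "a < c" "c \<le> T"
    and n: "\<And>t. t \<in> {a<..<c} \<Longrightarrow> n t = 0"
    and nofire: "\<And>t. t \<in> {a<..<c} \<Longrightarrow> \<theta> t \<noteq> 1"
  shows "\<theta> c = (let y = reset (\<theta> a) + (c - a) in if n c \<ge> 1 then min 1 (Hm b \<epsilon> (n c) y) else y)"
proof -
  define m where "m = (a + c) / 2"
  define K where "K = \<theta> m - m"
  have m: "m \<in> {a<..<c}"
    using a by (simp add: m_def)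
  have "((\<lambda>t. \<theta> t - t) has_real_derivative 0) (at t)" if "t \<in> {a<..<c}" for t
  proof -
    have "(\<theta> has_real_derivative 1) (at t)"
      using run that a n nofire unfolding osc_run_def by auto
    then show ?thesis
      by (auto intro!: derivative_eq_intros)
  qed
  then have lin: "\<theta> t = K + t" if "t \<in> {a<..<c}" for t
    using DERIV_isconst3[of a c t m "\<lambda>t. \<theta> t - t"] that m a by (auto simp: K_def)
  have evr: "\<forall>\<^sub>F t in at_right a. \<theta> t = K + t"
    using eventually_at_right_real[OF a(2)] by eventually_elim (simp add: lin)
  have evl: "\<forall>\<^sub>F t in at_left c. \<theta> t = K + t"
    using eventually_at_left_real[OF a(2)] by eventually_elim (simp add: lin)
  have "((\<lambda>t. K + t) \<longlongrightarrow> K + a) (at_right a)"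
    by (intro tendsto_intros)
  then have "(\<theta> \<longlongrightarrow> K + a) (at_right a)"
    using evr by (simp add: filterlim_cong)
  moreover have "(\<theta> \<longlongrightarrow> reset (\<theta> a)) (at_right a)"
    using run a unfolding osc_run_def by auto
  ultimately have K: "K + a = reset (\<theta> a)"
    by (intro tendsto_unique) auto
  have "((\<lambda>t. K + t) \<longlongrightarrow> K + c) (at_left c)"
    by (intro tendsto_intros)
  then have lim: "(\<theta> \<longlongrightarrow> K + c) (at_left c)"
    using evl by (simp add: filterlim_cong)
  have "c \<in> {0<..T}"
    using a by simp
  then obtain l where l: "(\<theta> \<longlongrightarrow> l) (at_left c)"
    "\<theta> c = (if n c \<ge> 1 then min 1 (Hm b \<epsilon> (n c) l) else l)"
    using run unfolding osc_run_def by blast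
  have "l = K + c"
    using l(1) lim by (intro tendsto_unique) auto
  also have "\<dots> = reset (\<theta> a) + (c - a)"
    using K by simp
  finally show ?thesis
    using l(2) by (simp add: Let_def)
qed

text \<open>Absence of firings follows from \<open>le\<close>: a first firing before
  \<open>c\<close> would end a ramp whose height is still below 1.\<close>

lemma linear_between_pulses:
  assumes run: "osc_run b \<epsilon> T n \<theta>" and a: "0 \<le> a" "a < c" "c \<le> T"
    and n: "\<And>t. t \<in> {a<..<c} \<Longrightarrow> n t = 0"
    and le: "reset (\<theta> a) + (c - a) \<le> 1"
  shows "\<theta> c = (let y = reset (\<theta> a) + (c - a) in if n c \<ge> 1 then min 1 (Hm b \<epsilon> (n c) y) else y)"
proof (rule linear_between_events[OF run a n])
  fix t assume t: "t \<in> {a<..<c}"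
  show "\<theta> t \<noteq> 1"
  proof
    assume "\<theta> t = 1"
    \<comment> \<open>Firings are finite in number, so there is a first one; up to it the previous
      lemma applies.\<close>
    define A where "A = {t \<in> {a<..<c}. \<theta> t = 1}"
    have "A \<subseteq> {t \<in> {0..T}. \<theta> t = 1}"
      using a by (auto simp: A_def)
    then have fin: "finite A"
      using run unfolding osc_run_def by (meson finite_subset)
    have ne: "A \<noteq> {}"
      using t \<open>\<theta> t = 1\<close> by (auto simp: A_def)
    have m: "Min A \<in> A"
      using fin ne by simp
    have "\<theta> s \<noteq> 1" if "s \<in> {a<..<Min A}" for s
    proof
      assume "\<theta> s = 1"
      then have "s \<in> A"
        using that m by (auto simp: A_def)
      then show False
        using that Min_le[OF fin] by fastforce
    qed
    moreover have "n s = 0" if "s \<in> {a<..Min A}" for s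
      using n that m by (auto simp: A_def)
    moreover have A: "a < Min A" "Min A < c" "\<theta> (Min A) = 1"
      using m by (simp_all add: A_def)
    ultimately have "\<theta> (Min A) = reset (\<theta> a) + (Min A - a)"
      using linear_between_events[OF run a(1), of "Min A"] a(3) by simp
    then show False
      using A le by simp
  qed
qed auto

section \<open>Oscillators that receive two pulses\<close>

text \<open>
  Here \<open>x0\<close>, \<open>x1\<close>, \<open>x2\<close> are the phases, before a possible reset, at time \<open>0\<close> and at the arrival
  times \<open>u < v\<close> of the two pulses.
\<close>

definition saw :: "real \<Rightarrow> real \<Rightarrow> real \<Rightarrow> real \<Rightarrow> real \<Rightarrow> real \<Rightarrow> real" where
  "saw x0 u x1 v x2 t =
    (if t \<le> 0 then x0 else if t < u then reset x0 + t else if t = u then x1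
     else if t < v then reset x1 + (t - u) else if t = v then x2 else reset x2 + (t - v))"

text \<open>The inequalities for \<open>u\<close> and \<open>v\<close> let a ramp touch 1 only at
  the arrival that ends it. The one for \<open>T\<close> is strict because no arrival ends the last
  ramp.\<close>

locale two_pulses =
  fixes b \<epsilon> T x0 u x1 v x2 :: real
  assumes uv: "0 < u" "u < v" "v \<le> T"
    and x0: "0 \<le> x0" "x0 \<le> 1" and x1: "0 \<le> x1" and x2: "0 \<le> x2"
    and u: "reset x0 + u \<le> 1" "x1 = min 1 (Hm b \<epsilon> 1 (reset x0 + u))"
    and v: "reset x1 + (v - u) \<le> 1" "x2 = min 1 (Hm b \<epsilon> 1 (reset x1 + (v - u)))"
    and T: "reset x2 + (T - v) < 1"
begin

abbreviation phi :: "real \<Rightarrow> real" where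
  "phi \<equiv> saw x0 u x1 v x2"

definition pulses :: "real \<Rightarrow> nat" where
  "pulses t = (if t = u \<or> t = v then 1 else 0)"

lemma x1_le: "x1 \<le> 1" and x2_le: "x2 \<le> 1"
  using u v by simp_all

lemma reset_bounds: "0 \<le> x \<Longrightarrow> x \<le> 1 \<Longrightarrow> 0 \<le> reset x \<and> reset x < 1"
  by (auto simp: reset_def)

lemmas resets = reset_bounds[OF x0] reset_bounds[OF x1 x1_le] reset_bounds[OF x2 x2_le]

text \<open>Each of the first two ramps is strictly below its end value, which is at most 1, and the
  last stays below 1 up to \<open>T\<close>. So firings occur only at time 0 or at an
  arrival.\<close>

lemma phi_eq_1_iff:
  assumes "0 \<le> t" "t \<le> T"
  shows "phi t = 1 \<longleftrightarrow> (t = 0 \<and> x0 = 1) \<or> (t = u \<and> x1 = 1) \<or> (t = v \<and> x2 = 1)"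
proof -
  consider "t = 0" | "0 < t" "t < u" | "t = u" | "u < t" "t < v" | "t = v" | "v < t"
    using assms by linarith
  then show ?thesis
    by cases (use assms resets uv u(1) v(1) T in \<open>simp_all add: saw_def\<close>)
qed

lemma phi_bounds:
  assumes "0 \<le> t" "t \<le> T"
  shows "0 \<le> phi t \<and> phi t \<le> 1"
proof -
  consider "t = 0" | "0 < t" "t < u" | "t = u" | "u < t" "t < v" | "t = v" | "v < t"
    using assms by linarith
  then show ?thesis
    by cases (use assms resets uv u(1) v(1) T x0 x1 x2 x1_le x2_le in \<open>simp_all add: saw_def\<close>)
qed

lemma phi_segments:
  shows "t \<in> {0<..<u} \<Longrightarrow> phi t = reset x0 + t"
    and "t \<in> {u<..<v} \<Longrightarrow> phi t = (reset x1 - u) + t"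
    and "t \<in> {v<..} \<Longrightarrow> phi t = (reset x2 - v) + t"
  using uv by (auto simp: saw_def)

lemma phi_left_limit:
  assumes "\<And>t. t \<in> {a<..<c} \<Longrightarrow> phi t = K + t" "a < c"
  shows "(phi \<longlongrightarrow> K + c) (at_left c)"
proof -
  have "\<forall>\<^sub>F t in at_left c. phi t = K + t"
    using eventually_at_left_real[OF assms(2)] by eventually_elim (simp add: assms)
  moreover have "((\<lambda>t. K + t) \<longlongrightarrow> K + c) (at_left c)"
    by (intro tendsto_intros)
  ultimately show ?thesis
    by (simp add: filterlim_cong)
qed

lemma phi_right_limit:
  assumes "\<And>t. t \<in> {a<..<c} \<Longrightarrow> phi t = K + t" "a < c"
  shows "(phi \<longlongrightarrow> K + a) (at_right a)"
proof -
  have "\<forall>\<^sub>F t in at_right a. phi t = K + t"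
    using eventually_at_right_real[OF assms(2)] by eventually_elim (simp add: assms)
  moreover have "((\<lambda>t. K + t) \<longlongrightarrow> K + a) (at_right a)"
    by (intro tendsto_intros)
  ultimately show ?thesis
    by (simp add: filterlim_cong)
qed

lemma deriv_linear_piece:
  assumes "\<And>t. t \<in> {a<..<c} \<Longrightarrow> phi t = K + t" "t \<in> {a<..<c}"
  shows "(phi has_real_derivative 1) (at t)"
proof (rule has_field_derivative_transform_within_open[where S = "{a<..<c}"])
  show "((\<lambda>t. K + t) has_real_derivative 1) (at t)"
    by (auto intro!: derivative_eq_intros)
qed (use assms in auto)

lemma phi_deriv:
  assumes "0 < t" "t \<noteq> u" "t \<noteq> v"
  shows "(phi has_real_derivative 1) (at t)"
proof -
  \<comment> \<open>The last piece is unbounded; \<open>t + 1\<close> is an arbitrary right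
    end.\<close>
  consider "t \<in> {0<..<u}" | "t \<in> {u<..<v}" | "t \<in> {v<..<t + 1}"
    using assms by fastforce
  then show ?thesis
  proof cases
    case 1
    show ?thesis
      by (rule deriv_linear_piece[OF phi_segments(1) 1])
  next
    case 2
    show ?thesis
      by (rule deriv_linear_piece[OF phi_segments(2) 2])
  next
    case 3
    show ?thesis
      by (rule deriv_linear_piece[OF phi_segments(3) 3]) simp
  qed
qed

text \<open>Existence of a run. The one-sided limits at 0, \<open>u\<close> and \<open>v\<close>
  come from the adjacent linear pieces, those at other times from differentiability.\<close>

lemma phi_osc_run: "osc_run b \<epsilon> T pulses phi"
  unfolding osc_run_def
proof (intro conjI ballI impI)
  have "{t \<in> {0..T}. phi t = 1} \<subseteq> {0, u, v}"
    using phi_eq_1_iff by auto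
  then show "finite {t \<in> {0..T}. phi t = 1}"
    by (rule finite_subset) simp
next
  fix t assume "t \<in> {0<..<T}" "phi t \<noteq> 1 \<and> pulses t = 0"
  then have "0 < t" "t \<noteq> u" "t \<noteq> v"
    by (auto simp: pulses_def split: if_splits)
  then show "(phi has_real_derivative 1) (at t)"
    by (rule phi_deriv)
next
  fix t assume t: "t \<in> {0<..T}"
  consider "t = u" | "t = v" | "t \<noteq> u" "t \<noteq> v"
    by blast
  then show "\<exists>l. (phi \<longlongrightarrow> l) (at_left t) \<and>
      phi t = (if pulses t \<ge> 1 then min 1 (Hm b \<epsilon> (pulses t) l) else l)"
  proof cases
    case 1
    have "(phi \<longlongrightarrow> reset x0 + u) (at_left u)"
      using phi_left_limit phi_segments(1) uv(1) by blast
    moreover have "phi u = min 1 (Hm b \<epsilon> 1 (reset x0 + u))"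
      using uv u by (simp add: saw_def)
    ultimately show ?thesis
      using 1 by (auto simp: pulses_def)
  next
    case 2
    have "(phi \<longlongrightarrow> (reset x1 - u) + v) (at_left v)"
      using phi_left_limit phi_segments(2) uv(2) by blast
    moreover have "(reset x1 - u) + v = reset x1 + (v - u)"
      by simp
    moreover have "phi v = min 1 (Hm b \<epsilon> 1 (reset x1 + (v - u)))"
      using uv v by (simp add: saw_def)
    ultimately show ?thesis
      using 2 by (intro exI[of _ "reset x1 + (v - u)"]) (simp add: pulses_def)
  next
    case 3
    then have "phi \<midarrow>t\<rightarrow> phi t"
      using t DERIV_isCont[OF phi_deriv] by (simp add: isCont_def)
    then have "(phi \<longlongrightarrow> phi t) (at_left t)"
      by (simp add: filterlim_at_split)
    then show ?thesis
      using 3 by (auto simp: pulses_def)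
  qed
next
  fix t assume t: "t \<in> {0..<T}"
  consider "t = 0" | "t = u" | "t = v" | "0 < t" "t \<noteq> u" "t \<noteq> v"
    using t by force
  then show "(phi \<longlongrightarrow> reset (phi t)) (at_right t)"
  proof cases
    case 1
    then show ?thesis
      using phi_right_limit[of 0 u "reset x0"] phi_segments(1) uv by (simp add: saw_def)
  next
    case 2
    then show ?thesis
      using phi_right_limit[of u v "reset x1 - u"] phi_segments(2) uv by (simp add: saw_def)
  next
    case 3
    then show ?thesis
      using phi_right_limit[of v "v + 1" "reset x2 - v"] phi_segments(3) uv by (simp add: saw_def)
  next
    case 4
    then have "phi \<midarrow>t\<rightarrow> phi t"
      using DERIV_isCont[OF phi_deriv] by (simp add: isCont_def)
    then have "(phi \<longlongrightarrow> phi t) (at_right t)"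
      by (simp add: filterlim_at_split)
    moreover have "phi t \<noteq> 1"
      using phi_eq_1_iff 4 t by auto
    ultimately show ?thesis
      by (simp add: reset_def)
  qed
qed (use phi_bounds in auto)

text \<open>Uniqueness of the run, interval by interval. A shorter horizon \<open>T'\<close> is
  allowed so that trajectories of unknown length can be compared with \<open>phi\<close>.\<close>

lemma osc_run_eq_phi:
  assumes run: "osc_run b \<epsilon> T' pulses \<theta>" and "T' \<le> T"
    and init: "\<theta> 0 = x0" and t: "0 \<le> t" "t \<le> T'"
  shows "\<theta> t = phi t"
proof -
  \<comment> \<open>An arbitrary right end \<open>s\<close> of the ramp yields the interior values
    and the jump at \<open>u\<close> at once.\<close>
  have upto_u: "\<theta> s = phi s" if "0 < s" "s \<le> u" "s \<le> T'" for s
    using linear_between_pulses[OF run, of 0 s] that init u uv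
    by (auto simp: pulses_def saw_def Let_def)
  have upto_v: "\<theta> s = phi s" if "u < s" "s \<le> v" "s \<le> T'" for s
  proof -
    have "\<theta> u = x1"
      using upto_u[of u] that uv by (simp add: saw_def)
    then show ?thesis
      using linear_between_pulses[OF run, of u s] that v uv
      by (auto simp: pulses_def saw_def Let_def)
  qed
  have after_v: "\<theta> s = phi s" if "v < s" "s \<le> T'" for s
  proof -
    have "\<theta> v = x2"
      using upto_v[of v] that uv by (simp add: saw_def)
    then show ?thesis
      using linear_between_pulses[OF run, of v s] that T uv \<open>T' \<le> T\<close>
      by (auto simp: pulses_def saw_def Let_def)
  qed
  consider "t = 0" | "0 < t" "t \<le> u" | "u < t" "t \<le> v" | "v < t"
    using t by linarith
  then show ?thesis
    by cases (use init t upto_u upto_v after_v in \<open>auto simp: saw_def\<close>)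
qed

end

section \<open>The network\<close>

locale network_state =
  fixes b \<epsilon> \<tau> \<sigma>1 \<sigma>2 \<sigma>3 :: real
  assumes b: "b > 0" and \<epsilon>: "\<epsilon> \<ge> 0" and Om: "(\<sigma>1, \<sigma>2, \<sigma>3) \<in> Omega b \<epsilon> \<tau>"
begin

abbreviation h :: "real \<Rightarrow> real" where
  "h \<equiv> Hm b \<epsilon> 1"

lemma order: "0 < \<sigma>2" "\<sigma>2 < \<sigma>1" "\<sigma>1 < \<sigma>3" "\<sigma>3 < \<tau>"
  using Om by (auto simp: Omega_def)

lemma upper_bounds:
  "h \<sigma>1 + \<tau> - \<sigma>3 \<le> 1" "h (\<tau> - \<sigma>3 + \<sigma>2) + \<sigma>3 - \<sigma>1 \<le> 1"
  "h (\<tau> - \<sigma>1) + \<sigma>1 - \<sigma>2 \<le> 1" "h (\<sigma>3 - \<sigma>2) + \<sigma>2 \<le> 1"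
  using Om by (auto simp: Omega_def)

text \<open>The arguments of the outer \<open>h\<close> are \<open>F_1\<close>, \<open>F_2\<close>,
  \<open>F_3\<close>: the phases of oscillators 1, 2, 3 just before the pulse that makes them
  fire.\<close>

lemma pulse_causes_firing:
  "1 \<le> h (h \<sigma>1 + (\<tau> - \<sigma>3))"
  "1 \<le> h (h (\<tau> - \<sigma>3 + \<sigma>2) + (\<sigma>3 - \<sigma>1))"
  "1 \<le> h (h (\<tau> - \<sigma>1) + (\<sigma>1 - \<sigma>2))"
  using Om by (intro Hm_ge_1[OF b]; force simp: Omega_def)+

lemma h_ge_self:
  "\<sigma>1 \<le> h \<sigma>1" "\<sigma>3 - \<sigma>2 \<le> h (\<sigma>3 - \<sigma>2)"
  "\<tau> - \<sigma>3 + \<sigma>2 \<le> h (\<tau> - \<sigma>3 + \<sigma>2)" "\<tau> - \<sigma>1 \<le> h (\<tau> - \<sigma>1)"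
  using order by (auto intro!: Hm_ge_self[OF b \<epsilon>])

lemmas bounds = order upper_bounds h_ge_self

text \<open>Oscillator 1 hears 3, fires, and hears 2 at the return time, which lifts it to
  \<open>h (\<sigma>3 - \<sigma>2)\<close>.\<close>

sublocale osc1: two_pulses b \<epsilon> "\<tau> - \<sigma>2" "h \<sigma>1" "\<tau> - \<sigma>3" 1 "\<tau> - \<sigma>2" "h (\<sigma>3 - \<sigma>2)"
proof -
  have "reset (h \<sigma>1) = h \<sigma>1" "reset (h (\<sigma>3 - \<sigma>2)) = h (\<sigma>3 - \<sigma>2)" "reset 1 = 0"
    using bounds by (auto simp: reset_def)
  then show "two_pulses b \<epsilon> (\<tau> - \<sigma>2) (h \<sigma>1) (\<tau> - \<sigma>3) 1 (\<tau> - \<sigma>2) (h (\<sigma>3 - \<sigma>2))"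
    using bounds pulse_causes_firing by unfold_locales simp_all
qed

text \<open>Oscillator 2 hears 3 without firing, then hears 1 and fires; it ends at phase
  \<open>\<sigma>1 - \<sigma>2\<close>.\<close>

sublocale osc2: two_pulses b \<epsilon> "\<tau> - \<sigma>2" \<sigma>2 "\<tau> - \<sigma>3" "h (\<tau> - \<sigma>3 + \<sigma>2)" "\<tau> - \<sigma>1" 1
proof -
  have "reset \<sigma>2 = \<sigma>2" "reset (h (\<tau> - \<sigma>3 + \<sigma>2)) = h (\<tau> - \<sigma>3 + \<sigma>2)" "reset 1 = 0"
    using bounds by (auto simp: reset_def)
  then show "two_pulses b \<epsilon> (\<tau> - \<sigma>2) \<sigma>2 (\<tau> - \<sigma>3) (h (\<tau> - \<sigma>3 + \<sigma>2)) (\<tau> - \<sigma>1) 1"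
    using bounds pulse_causes_firing by unfold_locales (simp_all add: add.commute)
qed

text \<open>Oscillator 3 starts at 1, its value before the reset at time 0. It hears 1 without
  firing, then hears 2 and fires, which is the return.\<close>

sublocale osc3: two_pulses b \<epsilon> "\<tau> - \<sigma>2" 1 "\<tau> - \<sigma>1" "h (\<tau> - \<sigma>1)" "\<tau> - \<sigma>2" 1
proof -
  have "reset (h (\<tau> - \<sigma>1)) = h (\<tau> - \<sigma>1)" "reset 1 = 0"
    using bounds by (auto simp: reset_def)
  then show "two_pulses b \<epsilon> (\<tau> - \<sigma>2) 1 (\<tau> - \<sigma>1) (h (\<tau> - \<sigma>1)) (\<tau> - \<sigma>2) 1"
    using bounds pulse_causes_firing by unfold_locales simp_all
qed

definition start :: state where
  "start = section_state \<sigma>1 \<sigma>2 \<sigma>3 (h \<sigma>1) \<sigma>2"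

definition return :: state where
  "return = section_state (\<sigma>3 - \<sigma>2) (\<sigma>1 - \<sigma>2) (\<tau> - \<sigma>2) (h (\<sigma>3 - \<sigma>2)) (\<sigma>1 - \<sigma>2)"

definition solution :: "osc \<Rightarrow> real \<Rightarrow> real" where
  "solution = case_osc osc1.phi osc2.phi osc3.phi"

definition pulses :: "osc \<Rightarrow> real \<Rightarrow> nat" where
  "pulses = case_osc osc1.pulses osc2.pulses osc3.pulses"

lemma on_section_start: "on_section start"
  by (simp add: on_section_def start_def section_state_def)

section \<open>Pulses and firings up to the return time\<close>

context
  fixes \<theta> F
  assumes init: "state_at \<tau> \<theta> F 0 = start"
begin

text \<open>The initial state fixes the firing sets on \<open>{- \<tau><..0}\<close> only; earlier
  firings remain arbitrary.\<close>

lemma firing_history: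
  assumes "0 \<le> s" "s < \<tau>"
  shows "- s \<in> F Osc1 \<longleftrightarrow> s = \<sigma>1"
    and "- s \<in> F Osc2 \<longleftrightarrow> s = \<sigma>2"
    and "- s \<in> F Osc3 \<longleftrightarrow> s = \<sigma>3 \<or> s = 0"
proof -
  have "s \<in> ages start i \<longleftrightarrow> - s \<in> F i" for i
    using assms by (simp flip: init add: state_at_def)
  from this[of Osc1] this[of Osc2] this[of Osc3]
  show "- s \<in> F Osc1 \<longleftrightarrow> s = \<sigma>1" "- s \<in> F Osc2 \<longleftrightarrow> s = \<sigma>2" "- s \<in> F Osc3 \<longleftrightarrow> s = \<sigma>3 \<or> s = 0"
    by (auto simp: start_def section_state_def)
qed

text \<open>The pulse sent by oscillator 3 at time 0 arrives only at \<open>\<tau>\<close>, after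
  the return. The other three arrival times are distinct, so no two pulses coincide.\<close>

lemma num_pulses_eq:
  assumes "t \<in> {0<..\<tau> - \<sigma>2}"
  shows "num_pulses \<tau> F i t = pulses i t"
proof -
  have F: "t - \<tau> \<in> F Osc1 \<longleftrightarrow> t = \<tau> - \<sigma>1" "t - \<tau> \<in> F Osc2 \<longleftrightarrow> t = \<tau> - \<sigma>2"
    "t - \<tau> \<in> F Osc3 \<longleftrightarrow> t = \<tau> - \<sigma>3"
    using firing_history[of "\<tau> - t"] assms order by auto
  have "j \<in> {j. j \<noteq> i \<and> t - \<tau> \<in> F j} \<longleftrightarrow>
      j \<noteq> i \<and> (j = Osc1 \<and> t = \<tau> - \<sigma>1 \<or> j = Osc2 \<and> t = \<tau> - \<sigma>2 \<or> j = Osc3 \<and> t = \<tau> - \<sigma>3)" for j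
    by (cases j) (simp_all add: F)
  then have "{j. j \<noteq> i \<and> t - \<tau> \<in> F j} =
      (if t = \<tau> - \<sigma>1 then {Osc1} else if t = \<tau> - \<sigma>2 then {Osc2}
       else if t = \<tau> - \<sigma>3 then {Osc3} else {}) - {i}"
    using order by auto
  then show ?thesis
    unfolding num_pulses_def using order
    by (cases i) (auto simp: pulses_def osc1.pulses_def osc2.pulses_def osc3.pulses_def)
qed

lemma state_at_return:
  assumes sol: "\<And>i t. t \<in> {0..\<tau> - \<sigma>2} \<Longrightarrow> \<theta> i t = solution i t"
    and fire: "\<And>i t. t \<in> {0..\<tau> - \<sigma>2} \<Longrightarrow> t \<in> F i \<longleftrightarrow> \<theta> i t = 1"
  shows "state_at \<tau> \<theta> F (\<tau> - \<sigma>2) = return"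
proof -
  have "after_reset \<theta> F i (\<tau> - \<sigma>2) = reset (solution i (\<tau> - \<sigma>2))" for i
    using sol[of "\<tau> - \<sigma>2" i] fire[of "\<tau> - \<sigma>2" i] order by (simp add: after_reset_def reset_def)
  then have phases: "after_reset \<theta> F i (\<tau> - \<sigma>2) = phase return i" for i
    using bounds
    by (cases i) (auto simp: solution_def saw_def reset_def return_def section_state_def)
  have ages: "s \<in> ages return i \<longleftrightarrow> \<tau> - \<sigma>2 - s \<in> F i" if s: "0 \<le> s" "s < \<tau>" for i s
  \<comment> \<open>Ages up to \<open>\<tau> - \<sigma>2\<close> belong to firings during the run,
    including the one of oscillator 3 at time 0. The firings at \<open>- \<sigma>1\<close>,
    \<open>- \<sigma>2\<close>, \<open>- \<sigma>3\<close> now have age at least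
    \<open>\<tau>\<close>; the one of oscillator 2 has age exactly \<open>\<tau>\<close> and drops
    out because the window is half-open.\<close>
  proof (cases "s \<le> \<tau> - \<sigma>2")
    case True
    then have "\<tau> - \<sigma>2 - s \<in> F i \<longleftrightarrow> solution i (\<tau> - \<sigma>2 - s) = 1"
      using sol[of "\<tau> - \<sigma>2 - s" i] fire[of "\<tau> - \<sigma>2 - s" i] s by simp
    also have "\<dots> \<longleftrightarrow> s \<in> ages return i"
      using True s bounds
      by (cases i) (auto simp: solution_def return_def section_state_def
          osc1.phi_eq_1_iff osc2.phi_eq_1_iff osc3.phi_eq_1_iff)
    finally show ?thesis ..
  next
    case False
    then show ?thesis
      using firing_history[of "s - (\<tau> - \<sigma>2)"] s order
      by (cases i) (auto simp: return_def section_state_def)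
  qed
  have "s \<in> ages return i \<Longrightarrow> 0 \<le> s \<and> s < \<tau>" for i s
    using order by (cases i) (auto simp: return_def section_state_def)
  then have "{s. 0 \<le> s \<and> s < \<tau> \<and> \<tau> - \<sigma>2 - s \<in> F i} = ages return i" for i
    using ages by blast
  with phases show ?thesis
    by (simp add: state_at_def)
qed

end

section \<open>Uniqueness and existence of the Poincare step\<close>

text \<open>Up to the return time the arrivals are known from the initial state, so uniqueness holds
  for each oscillator separately.\<close>

lemma trajectory_eq_solution:
  assumes traj: "trajectory b \<epsilon> \<tau> start T \<theta> F" and t: "0 \<le> t" "t \<le> T" "t \<le> \<tau> - \<sigma>2"
  shows "\<theta> i t = solution i t"
proof -
  have init: "state_at \<tau> \<theta> F 0 = start"
    and fire: "\<And>i. 0 \<in> F i \<longleftrightarrow> \<theta> i 0 = 1"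
    and run: "\<And>i. osc_run b \<epsilon> T (num_pulses \<tau> F i) (\<theta> i)"
    using traj t unfolding trajectory_iff_osc_run by auto
  have "osc_run b \<epsilon> t (pulses i) (\<theta> i)" for i
    using osc_run_mono[OF run t(2)] by (rule osc_run_cong) (use num_pulses_eq[OF init] t in auto)
  note runs = this[of Osc1] this[of Osc2] this[of Osc3]
  \<comment> \<open>The state stores phases after the reset. Knowing who fires at time 0 recovers
    the values before it: only oscillator 3 fires, so it starts at 1.\<close>
  have F0: "0 \<notin> F Osc1" "0 \<notin> F Osc2" "0 \<in> F Osc3"
    using firing_history[OF init, of 0] order by auto
  have "after_reset \<theta> F i 0 = phase start i" for i
    by (simp flip: init add: state_at_def)
  from this[of Osc1] this[of Osc2] have "\<theta> Osc1 0 = h \<sigma>1" "\<theta> Osc2 0 = \<sigma>2"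
    using F0 by (simp_all add: after_reset_def start_def section_state_def)
  moreover have "\<theta> Osc3 0 = 1"
    using F0 fire by blast
  ultimately show ?thesis
    using osc1.osc_run_eq_phi[of t "\<theta> Osc1" t] osc2.osc_run_eq_phi[of t "\<theta> Osc2" t]
      osc3.osc_run_eq_phi[of t "\<theta> Osc3" t] runs t
    by (cases i) (simp_all add: solution_def pulses_def)
qed

lemma solution_osc3_eq_1_iff:
  assumes "0 < t" "t \<le> \<tau> - \<sigma>2"
  shows "solution Osc3 t = 1 \<longleftrightarrow> t = \<tau> - \<sigma>2"
  using assms bounds by (auto simp: solution_def osc3.phi_eq_1_iff)

lemma poincare_step_unique:
  assumes "poincare_step b \<epsilon> \<tau> start s'"
  shows "s' = return"
proof -
  obtain T \<theta> F where T: "T > 0" and traj: "trajectory b \<epsilon> \<tau> start T \<theta> F"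
    and "T \<in> F Osc3" and first: "\<And>t. t \<in> {0<..<T} \<Longrightarrow> t \<notin> F Osc3"
    and s': "s' = state_at \<tau> \<theta> F T"
    using assms unfolding poincare_step_def by blast
  have init: "state_at \<tau> \<theta> F 0 = start"
    and fire: "\<And>i t. t \<in> {0..T} \<Longrightarrow> t \<in> F i \<longleftrightarrow> \<theta> i t = 1"
    using traj unfolding trajectory_iff_osc_run by auto
  \<comment> \<open>A smaller \<open>T\<close> is no firing time of oscillator 3; a larger one is
    not its first.\<close>
  have "\<not> T < \<tau> - \<sigma>2"
    using trajectory_eq_solution[OF traj, of T Osc3] solution_osc3_eq_1_iff[of T]
      fire[of T Osc3] \<open>T \<in> F Osc3\<close> T by auto
  moreover have "\<not> \<tau> - \<sigma>2 < T"
    using trajectory_eq_solution[OF traj, of "\<tau> - \<sigma>2" Osc3] solution_osc3_eq_1_iff[of "\<tau> - \<sigma>2"]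
      fire[of "\<tau> - \<sigma>2" Osc3] first[of "\<tau> - \<sigma>2"] order by auto
  ultimately have "T = \<tau> - \<sigma>2"
    by simp
  then show ?thesis
    using state_at_return[OF init] trajectory_eq_solution[OF traj] fire s' by simp
qed

lemma poincare_step_exists: "poincare_step b \<epsilon> \<tau> start return"
proof -
  \<comment> \<open>The firings recorded in the initial state, together with those of
    \<open>solution\<close> up to the return.\<close>
  define F where "F = case_osc {- \<sigma>1, \<tau> - \<sigma>3} {- \<sigma>2, \<tau> - \<sigma>1} {- \<sigma>3, 0, \<tau> - \<sigma>2}"
  have F_pos: "t \<in> F i \<longleftrightarrow> solution i t = 1" if "t \<in> {0..\<tau> - \<sigma>2}" for i t
    using that bounds
    by (cases i) (auto simp: F_def solution_def
        osc1.phi_eq_1_iff osc2.phi_eq_1_iff osc3.phi_eq_1_iff)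
  have "after_reset solution F i 0 = phase start i" for i
    using order by (cases i) (auto simp: after_reset_def F_def solution_def saw_def
        start_def section_state_def)
  moreover have "{s. 0 \<le> s \<and> s < \<tau> \<and> 0 - s \<in> F i} = ages start i" for i
    using order by (cases i) (auto simp: F_def start_def section_state_def)
  ultimately have init: "state_at \<tau> solution F 0 = start"
    by (simp add: state_at_def)
  have "osc_run b \<epsilon> (\<tau> - \<sigma>2) (pulses i) (solution i)" for i
    using osc1.phi_osc_run osc2.phi_osc_run osc3.phi_osc_run
    by (cases i) (simp_all add: pulses_def solution_def)
  then have "osc_run b \<epsilon> (\<tau> - \<sigma>2) (num_pulses \<tau> F i) (solution i)" for i
    by (rule osc_run_cong) (simp add: num_pulses_eq[OF init])
  then have "trajectory b \<epsilon> \<tau> start (\<tau> - \<sigma>2) solution F"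
    using init F_pos by (simp add: trajectory_iff_osc_run)
  moreover have "return = state_at \<tau> solution F (\<tau> - \<sigma>2)"
    using state_at_return[OF init] F_pos by simp
  moreover have "\<tau> - \<sigma>2 \<in> F Osc3" "\<forall>t\<in>{0<..<\<tau> - \<sigma>2}. t \<notin> F Osc3" "\<tau> - \<sigma>2 > 0"
    using order by (auto simp: F_def)
  ultimately show ?thesis
    unfolding poincare_step_def using on_section_start by blast
qed

lemma poincare_map_start: "poincare_map b \<epsilon> \<tau> start = Some return"
proof -
  have "poincare_step b \<epsilon> \<tau> start = (\<lambda>s'. s' = return)"
    using poincare_step_unique poincare_step_exists by blast
  then show ?thesis
    by (simp add: poincare_map_def)
qed

end

section \<open>Invariance of the parameter set\<close>

text \<open>Composition with \<open>g_map\<close> turns \<open>F_1\<close>, \<open>F_2\<close>,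
  \<open>F_3\<close>, \<open>F_4\<close> into \<open>F_4\<close>, \<open>F_1\<close>,
  \<open>F_2\<close>, \<open>F_3\<close>, and likewise rotates the four gaps in
  \<open>0 < \<sigma>2 < \<sigma>1 < \<sigma>3 < \<tau>\<close>.\<close>

lemma g_map_in_Omega_iff: "g_map \<tau> \<sigma> \<in> Omega b \<epsilon> \<tau> \<longleftrightarrow> \<sigma> \<in> Omega b \<epsilon> \<tau>"
  by (cases \<sigma>) (auto simp: g_map_def Omega_def algebra_simps)

lemma surj_g_map: "surj (g_map \<tau>)"
proof (rule surjI)
  \<comment> \<open>The inverse: the third coordinate gives \<open>\<sigma>2 = \<tau> - z\<close>,
    and the other two then give \<open>\<sigma>3\<close> and \<open>\<sigma>1\<close>.\<close>
  show "g_map \<tau> ((\<lambda>(x, y, z). (y + \<tau> - z, \<tau> - z, x + \<tau> - z)) \<sigma>) = \<sigma>" for \<sigma>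
    by (cases \<sigma>) (simp add: g_map_def)
qed

lemma g_map_image_Omega: "g_map \<tau> ` Omega b \<epsilon> \<tau> = Omega b \<epsilon> \<tau>"
proof -
  \<comment> \<open>Surjectivity turns this equality with the preimage into one with the
    image.\<close>
  have "Omega b \<epsilon> \<tau> = g_map \<tau> -` Omega b \<epsilon> \<tau>"
    using g_map_in_Omega_iff by blast
  then show ?thesis
    using surj_image_vimage_eq[OF surj_g_map] by metis
qed

theorem mainTheorem2:
  fixes b \<epsilon> \<tau> :: real
  assumes "b > 0" and "\<epsilon> \<ge> 0" and "\<tau> > 0"
  shows "g_map \<tau> ` Omega b \<epsilon> \<tau> = Omega b \<epsilon> \<tau> \<and>
    (\<forall>\<sigma>\<in>Omega b \<epsilon> \<tau>.
       poincare_map b \<epsilon> \<tau> (S_state b \<epsilon> \<sigma>) = Some (S_state b \<epsilon> (g_map \<tau> \<sigma>))) \<and>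
    (\<forall>(\<sigma>1, \<sigma>2, \<sigma>3)\<in>Omega b \<epsilon> \<tau>.
       poincare_map b \<epsilon> \<tau> (section_state \<sigma>1 \<sigma>2 \<sigma>3 (Hm b \<epsilon> 1 \<sigma>1) \<sigma>2) =
         Some (section_state (\<sigma>3 - \<sigma>2) (\<sigma>1 - \<sigma>2) (\<tau> - \<sigma>2)
                 (Hm b \<epsilon> 1 (\<sigma>3 - \<sigma>2)) (\<sigma>1 - \<sigma>2)))"
proof -
  have map: "poincare_map b \<epsilon> \<tau> (section_state \<sigma>1 \<sigma>2 \<sigma>3 (Hm b \<epsilon> 1 \<sigma>1) \<sigma>2) =
      Some (section_state (\<sigma>3 - \<sigma>2) (\<sigma>1 - \<sigma>2) (\<tau> - \<sigma>2) (Hm b \<epsilon> 1 (\<sigma>3 - \<sigma>2)) (\<sigma>1 - \<sigma>2))"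
    if "(\<sigma>1, \<sigma>2, \<sigma>3) \<in> Omega b \<epsilon> \<tau>" for \<sigma>1 \<sigma>2 \<sigma>3
  proof -
    interpret network_state b \<epsilon> \<tau> \<sigma>1 \<sigma>2 \<sigma>3
      using assms that by unfold_locales
    show ?thesis
      using poincare_map_start by (simp add: start_def return_def)
  qed
  have "poincare_map b \<epsilon> \<tau> (S_state b \<epsilon> \<sigma>) = Some (S_state b \<epsilon> (g_map \<tau> \<sigma>))"
    if "\<sigma> \<in> Omega b \<epsilon> \<tau>" for \<sigma>
    using that map by (cases \<sigma>) (simp add: S_state_def g_map_def)
  with map g_map_image_Omega show ?thesis
    by blast
qed

end
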